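(* Let $P_n$ be the path on $n$ vertices. For all integers $n\geq k\geq 3$, the inequality $p_k(P_n)\leq \left\lfloor \frac{3k}{2}\right\rfloor-1$ holds.
   Context: All graphs are finite simple graphs. $d_G(v,w)$ denotes the distance in $G$ between vertices $v$ and $w$. For a positive integer $p$, the $p$-th power $G^p$ of a graph $G$ is the simple graph with the same vertex set as $G$ in which two distinct vertices $v,w$ are adjacent if and only if $d_G(v,w)\leq p$. A graph $G$ is $k$-ordered Hamiltonian if for any sequence $v_1,v_2,\dots,v_k$ of $k$ distinct vertices of $G$ there is a Hamiltonian cycle in $G$ containing these vertices in the given order, i.e. traversing the cycle from $v_1$ in one of its two directions, one meets $v_1,v_2,\dots,v_k$ in this order before returning to $v_1$. For $k\geq 3$ and a graph $G$, $p_k(G)$ denotes the smallest integer $p$ such that $G^p$ is $k$-ordered Hamiltonian. *)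

theory Defs
  imports "Graph_Theory.Graph_Theory" "HOL-Library.Sublist"
begin

text \<open>
  A finite simple graph is a \<^locale>\<open>pair_graph\<close>: a finite, loop-free, symmetric relation on a
  finite vertex set, so that an undirected edge is a pair of opposite arcs.
\<close>

text \<open>
  With unit weights \<^term>\<open>wf_digraph.\<mu>\<close> is the usual graph distance, with value
  infinity between vertices in different components.
\<close>

abbreviation graph_dist :: "'a pair_pre_digraph \<Rightarrow> 'a \<Rightarrow> 'a \<Rightarrow> ereal" where
  "graph_dist G \<equiv> wf_digraph.\<mu> (with_proj G) (\<lambda>_. 1)"

definition graph_power :: "'a pair_pre_digraph \<Rightarrow> nat \<Rightarrow> 'a pair_pre_digraph" where
  "graph_power G p = \<lparr> pverts = pverts G,
     parcs = {(v, w). v \<in> pverts G \<and> w \<in> pverts G \<and> v \<noteq> w \<and> graph_dist G v w \<le> ereal (real p)} \<rparr>"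

text \<open>
  A closed arc walk \<open>c\<close> visits the vertices \<open>map fst c\<close> in this order, starting at \<open>fst (hd c)\<close>.
  The bound on the length excludes the digraph cycles \<open>u, v, u\<close> running back and forth along
  one edge.
\<close>

definition hamiltonian_cycle :: "'a pair_pre_digraph \<Rightarrow> ('a \<times> 'a) awalk \<Rightarrow> bool" where
  "hamiltonian_cycle G c \<longleftrightarrow>
     pre_digraph.cycle (with_proj G) c \<and> 3 \<le> length c \<and> set (map fst c) = pverts G"

text \<open>
  An arc walk \<open>c\<close> fixes both a starting vertex and a direction of traversal of the underlying
  undirected cycle; since \<open>c\<close> is existentially quantified, both directions are allowed. The
  definition is only meant for positive \<open>k\<close>, as \<^term>\<open>hd []\<close> is unspecified.
\<close>

definition k_ordered_hamiltonian :: "nat \<Rightarrow> 'a pair_pre_digraph \<Rightarrow> bool" where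
  "k_ordered_hamiltonian k G \<longleftrightarrow>
     (\<forall>vs. length vs = k \<and> distinct vs \<and> set vs \<subseteq> pverts G \<longrightarrow>
       (\<exists>c. hamiltonian_cycle G c \<and> fst (hd c) = hd vs \<and> subseq vs (map fst c)))"

text \<open>
  Unspecified if no power of \<open>G\<close> is \<open>k\<close>-ordered Hamiltonian; see \<open>path_power_ex\<close> below for paths.
\<close>

definition ordered_power_number :: "nat \<Rightarrow> 'a pair_pre_digraph \<Rightarrow> nat" where
  "ordered_power_number k G = (LEAST p. 0 < p \<and> k_ordered_hamiltonian k (graph_power G p))"

definition path_graph :: "nat \<Rightarrow> nat pair_pre_digraph" where
  "path_graph n = \<lparr> pverts = {..<n}, parcs = {(i, j). i < n \<and> j < n \<and> (j = Suc i \<or> i = Suc j)} \<rparr>"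

lemma pair_graph_path_graph: "pair_graph (path_graph n)"
proof
  show "finite (parcs (path_graph n))"
    by (rule finite_subset[of _ "{..<n} \<times> {..<n}"]) (auto simp: path_graph_def)
  show "symmetric (with_proj (path_graph n))"
    by (auto simp: symmetric_def sym_def path_graph_def)
qed (auto simp: path_graph_def)

lemma (in pair_graph) graph_dist_commute: "graph_dist G u v = graph_dist G v u"
proof -
  have cost: "awalk_cost (\<lambda>_. 1) q = real (length q)" for q
    by (induction q) auto
  have len: "length (rev_path q) = length q" for q :: "('a \<times> 'a) awalk"
    by (induction q) auto
  have "graph_dist G u v \<le> graph_dist G v u" for u v
    unfolding \<mu>_def
  proof (rule INF_mono)
    fix q assume "q \<in> {q. awalk v q u}"
    then have "rev_path q \<in> {q. awalk u q v}" by simp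
    moreover have "awalk_cost (\<lambda>_. 1) (rev_path q) = awalk_cost (\<lambda>_. 1) q"
      by (simp add: cost len)
    ultimately show "\<exists>r\<in>{q. awalk u q v}.
        ereal (awalk_cost (\<lambda>_. 1) r) \<le> ereal (awalk_cost (\<lambda>_. 1) q)" by (metis order_refl)
  qed
  then show ?thesis by (blast intro: antisym)
qed

lemma pair_graph_graph_power:
  assumes "pair_graph G"
  shows "pair_graph (graph_power G p)"
proof -
  interpret pair_graph G by fact
  show ?thesis
  proof
    show "finite (parcs (graph_power G p))"
      by (rule finite_subset[of _ "pverts G \<times> pverts G"]) (auto simp: graph_power_def)
    show "symmetric (with_proj (graph_power G p))"
      by (auto simp: symmetric_def sym_def graph_power_def graph_dist_commute)
  qed (auto simp: graph_power_def)
qed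

lemma graph_dist_path_graph_le:
  assumes "i < n" "j < n"
  shows "graph_dist (path_graph n) i j \<le> ereal \<bar>real i - real j\<bar>"
proof -
  interpret pair_graph "path_graph n" by (rule pair_graph_path_graph)
  have verts: "pverts (path_graph n) = {..<n}" by (simp add: path_graph_def)
  have arc: "(i, Suc i) \<in> parcs (path_graph n)" if "Suc i < n" for i
    using that by (simp add: path_graph_def)
  have up: "\<exists>q. awalk i q (i + d) \<and> awalk_cost (\<lambda>_. 1) q = real d" if "i + d < n" for i d
    using that
  proof (induction d arbitrary: i)
    case 0
    then show ?case by (intro exI[of _ "[]"]) (auto simp: awalk_Nil_iff verts)
  next
    case (Suc d)
    from Suc.IH[of "Suc i"] Suc.prems obtain q
      where q: "awalk (Suc i) q (Suc i + d)" "awalk_cost (\<lambda>_. 1) q = real d" by auto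
    have "awalk i ((i, Suc i) # q) (i + Suc d)"
      using q(1) Suc.prems arc[of i] by (auto simp: awalk_Cons_iff)
    with q(2) show ?case by (intro exI[of _ "(i, Suc i) # q"]) auto
  qed
  have le: "graph_dist (path_graph n) i j \<le> ereal (real j - real i)" if ij: "i \<le> j" "j < n" for i j
  proof -
    obtain q where q: "awalk i q j" "awalk_cost (\<lambda>_. 1) q = real j - real i"
      using up[of i "j - i"] ij by auto
    then show ?thesis using min_cost_le_walk_cost[OF q(1), of "\<lambda>_. 1"] by simp
  qed
  show ?thesis
  proof (cases "i \<le> j")
    case True
    then show ?thesis using le[of i j] assms by simp
  next
    case False
    then show ?thesis using le[of j i] assms by (simp add: graph_dist_commute[of i j])
  qed
qed

lemma hamiltonian_cycleI:
  assumes xs: "distinct xs" "set xs = pverts G" "3 \<le> length xs"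
    and arcs: "set (zip xs (rotate1 xs)) \<subseteq> parcs G"
  shows "hamiltonian_cycle G (zip xs (rotate1 xs))"
proof -
  obtain x ys where x: "xs = x # ys" using xs(3) by (cases xs) auto
  have fst_zip: "map fst (zip xs (rotate1 xs)) = xs" by simp
  have cas: "pcas a (zip (a # as) (as @ [b])) b" for a b :: 'a and as
    by (induction as arbitrary: a) auto
  have vs: "pawalk_verts a (zip (a # as) (as @ [b])) = a # as @ [b]" for a b :: 'a and as
    by (induction as arbitrary: a) auto
  have "pre_digraph.cycle (with_proj G) (zip xs (rotate1 xs))"
    unfolding pre_digraph.cycle_def pre_digraph.awalk_def cas_with_proj_eq awalk_verts_with_proj_eq
    using cas[of x ys x] vs[of x ys x] xs arcs unfolding x by (intro exI[of _ x]) auto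
  then show ?thesis
    unfolding hamiltonian_cycle_def fst_zip using xs by simp
qed

lemma path_power_ex:
  assumes "3 \<le> k" "k \<le> n"
  shows "\<exists>p>0. k_ordered_hamiltonian k (graph_power (path_graph n) p)"
proof (intro exI[of _ n] conjI)
  let ?G = "graph_power (path_graph n) n"
  have verts: "pverts ?G = {..<n}" by (simp add: graph_power_def path_graph_def)
  have complete: "(i, j) \<in> parcs ?G" if "i < n" "j < n" "i \<noteq> j" for i j
  proof -
    have "ereal \<bar>real i - real j\<bar> \<le> ereal (real n)" using that by simp
    with graph_dist_path_graph_le[OF that(1,2)]
    have "graph_dist (path_graph n) i j \<le> ereal (real n)" by (rule order_trans)
    with that show ?thesis by (simp add: graph_power_def path_graph_def)
  qed
  show "k_ordered_hamiltonian k ?G"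
    unfolding k_ordered_hamiltonian_def
  proof (intro allI impI, elim conjE)
    fix vs assume vs: "length vs = k" "distinct vs" "set vs \<subseteq> pverts ?G"
    define xs where "xs = vs @ sorted_list_of_set ({..<n} - set vs)"
    have xs: "distinct xs" "set xs = pverts ?G" "3 \<le> length xs"
      using vs assms verts by (auto simp: xs_def)
    have "set (zip xs (rotate1 xs)) \<subseteq> parcs ?G"
    proof
      fix e assume "e \<in> set (zip xs (rotate1 xs))"
      then obtain i where i: "i < length xs" "e = (xs ! i, xs ! (Suc i mod length xs))"
        by (auto simp: in_set_zip nth_rotate1)
      have "Suc i mod length xs \<noteq> i" "Suc i mod length xs < length xs"
        using i(1) xs(3) by (auto simp: mod_Suc)
      then have "xs ! i \<noteq> xs ! (Suc i mod length xs)"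
        using i(1) xs(1) by (simp add: nth_eq_iff_index_eq)
      moreover have "xs ! i < n" "xs ! (Suc i mod length xs) < n"
        using i(1) \<open>Suc i mod length xs < length xs\<close> xs(2) verts by (metis lessThan_iff nth_mem)+
      ultimately show "e \<in> parcs ?G" unfolding i(2) by (intro complete)
    qed
    with xs have "hamiltonian_cycle ?G (zip xs (rotate1 xs))" by (intro hamiltonian_cycleI)
    moreover have "subseq vs (map fst (zip xs (rotate1 xs)))"
      by (auto simp: xs_def intro: prefix_imp_subseq)
    moreover have "fst (hd (zip xs (rotate1 xs))) = hd vs"
    proof -
      have "hd (zip as bs) = (hd as, hd bs)" if "as \<noteq> []" "bs \<noteq> []" for as bs :: "nat list"
        using that by (cases as; cases bs) auto
      moreover have "vs \<noteq> []" "xs \<noteq> []" "rotate1 xs \<noteq> []" using vs(1) xs(3) assms by auto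
      ultimately show ?thesis by (simp add: xs_def)
    qed
    ultimately show "\<exists>c. hamiltonian_cycle ?G c \<and> fst (hd c) = hd vs \<and> subseq vs (map fst c)"
      by blast
  qed
  show "0 < n" using assms by simp
qed

end

theory Submission
  imports Defs "HOL-Library.Multiset"
begin

text \<open>
  Start from the cyclic sequence of the prescribed vertices and scan the path from the least of them
  to the greatest. Every vertex that is not prescribed is inserted into a pair of consecutive cycle
  vertices lying on both sides of it; among these pairs we take one whose smaller entry is least.
  A pair with smaller entry \<open>y\<close> thus waits at most for the pairs that cross the cut
  after \<open>y\<close>, of which there are at most twice as many as prescribed vertices on either
  side of the cut. This bounds the final length of the pair by \<open>k + k div 2 - 1\<close>. Finally the
  vertices beyond the extreme prescribed ones are inserted one by one next to the end
  reached so far.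
\<close>

section \<open>Cyclically consecutive pairs of a list and insertion between them\<close>

text \<open>As a multiset, the pairs forget their positions, so an insertion replaces one pair by
  two, even at the closing pair from last to first.\<close>

definition gaps :: "'a list \<Rightarrow> ('a \<times> 'a) multiset" where
  "gaps c = mset (zip c (rotate1 c))"

lemma zip_append_tl:
  "zip (as @ bs) (tl (as @ bs) @ [e]) =
     zip as (tl as @ [hd (bs @ [e])]) @ zip bs (tl bs @ [e])"
proof (induction as)
  case Nil
  then show ?case by simp
next
  case (Cons a as)
  then show ?case by (cases as; cases bs) auto
qed

lemma rotate1_conv_tl: "c \<noteq> [] \<Longrightarrow> rotate1 c = tl c @ [hd c]"
  by (cases c) auto

lemma image_fst_gaps: "image_mset fst (gaps c) = mset c"
  by (simp add: gaps_def flip: mset_map)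

lemma image_snd_gaps: "image_mset snd (gaps c) = mset c"
  by (cases c) (simp_all add: gaps_def flip: mset_map)

lemma gaps_in_set:
  assumes "(l, r) \<in># gaps c"
  shows "l \<in> set c" "r \<in> set c"
  using assms by (auto simp: gaps_def dest: set_zip_leftD set_zip_rightD)

text \<open>The new entry goes directly after the position of \<open>l\<close>. At the closing pair
  it is appended, so the head survives in every case.\<close>

lemma insert_in_gap:
  assumes "(l, r) \<in># gaps c"
  obtains c' where "gaps c' = gaps c - {#(l, r)#} + {#(l, z), (z, r)#}"
    "mset c' = add_mset z (mset c)" "subseq c c'" "hd c' = hd c"
proof -
  from assms obtain i where i: "i < length c" "l = c ! i" "r = rotate1 c ! i"
    by (auto simp: gaps_def in_set_zip)
  define as bs where "as = take i c" and "bs = drop (Suc i) c"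
  have c: "c = (as @ [l]) @ bs"
    using i by (simp add: as_def bs_def id_take_nth_drop[symmetric])
  \<comment> \<open>\<open>e\<close> heads both the old and the new list, so it closes both
    cycles.\<close>
  define e where "e = hd (as @ [l])"
  have e: "hd c = e" "hd ((as @ [l]) @ z # bs) = e" by (simp_all add: c e_def hd_append)
  have len: "length as = i" using i by (simp add: as_def)
  have "r = (tl c @ [hd c]) ! i" using i by (cases c) auto
  also have "\<dots> = hd (bs @ [e])"
    unfolding e(1) unfolding c using len by (cases as; cases bs) (auto simp: nth_append)
  finally have r: "r = hd (bs @ [e])" .
  have split: "zip (as @ [l]) (tl (as @ [l]) @ [w]) = zip as (tl as @ [l]) @ [(l, w)]" for w
    using zip_append_tl[of as "[l]" w] by simp
  have "gaps c = mset (zip ((as @ [l]) @ bs) (tl ((as @ [l]) @ bs) @ [e]))"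
    unfolding gaps_def using rotate1_conv_tl[of c] e(1) i(1) c by fastforce
  also have "\<dots> = mset (zip as (tl as @ [l])) + {#(l, r)#} + mset (zip bs (tl bs @ [e]))"
    unfolding zip_append_tl split r by simp
  finally have g: "gaps c = \<dots>" .
  have "gaps ((as @ [l]) @ z # bs) =
      mset (zip ((as @ [l]) @ z # bs) (tl ((as @ [l]) @ z # bs) @ [e]))"
    unfolding gaps_def using rotate1_conv_tl[of "(as @ [l]) @ z # bs"] e(2) by fastforce
  also have "\<dots> = mset (zip as (tl as @ [l])) + {#(l, z)#} + mset (zip (z # bs) (bs @ [e]))"
    unfolding zip_append_tl split by simp
  also have "mset (zip (z # bs) (bs @ [e])) = {#(z, r)#} + mset (zip bs (tl bs @ [e]))"
    unfolding r by (cases bs) auto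
  finally have "gaps ((as @ [l]) @ z # bs) = gaps c - {#(l, r)#} + {#(l, z), (z, r)#}"
    using g by simp
  moreover have "subseq c ((as @ [l]) @ z # bs)"
    unfolding c
    by (rule list_emb_append_mono[OF subseq_order.order_refl list_emb_Cons[OF subseq_order.order_refl]])
  ultimately show thesis
    using e by (intro that[of "(as @ [l]) @ z # bs"]) (auto simp: c)
qed

text \<open>Otherwise membership in \<open>S\<close> would propagate around the cycle from
  \<open>u\<close> to \<open>v\<close>.\<close>

lemma exists_leaving_gap:
  assumes "u \<in> set c" "u \<in> S" "v \<in> set c" "v \<notin> S"
  obtains l r where "(l, r) \<in># gaps c" "l \<in> S" "r \<notin> S"
proof (rule ccontr)
  assume "\<not> thesis"
  with that have closed: "r \<in> S"
    if "(l, r) \<in># gaps c" "l \<in> S" for l r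
    using that by blast
  let ?n = "length c"
  have step: "c ! (Suc i mod ?n) \<in> S" if "i < ?n" "c ! i \<in> S" for i
  proof (rule closed)
    show "(c ! i, c ! (Suc i mod ?n)) \<in># gaps c"
      using that by (auto simp: gaps_def in_set_zip nth_rotate1)
  qed (use that in auto)
  obtain i j where i: "i < ?n" "c ! i = u" and j: "j < ?n" "c ! j = v"
    using assms by (auto simp: in_set_conv_nth)
  have "c ! ((i + d) mod ?n) \<in> S" for d
  proof (induction d)
    case 0
    then show ?case using i assms by simp
  next
    case (Suc d)
    have "(i + d) mod ?n < ?n" using i by (intro mod_less_divisor) auto
    from step[OF this Suc] show ?case by (simp add: mod_Suc_eq)
  qed
  \<comment> \<open>This many steps lead from position \<open>i\<close> once past the end of the
    list to position \<open>j\<close>.\<close>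
  from this[of "?n - i + j"] show False using i j assms by simp
qed

lemma distinct_neighbours:
  assumes "distinct c" "3 \<le> length c" "v \<in> set c"
  obtains u w where "(u, v) \<in># gaps c" "(v, w) \<in># gaps c" "u \<noteq> w" "u \<noteq> v" "w \<noteq> v"
proof -
  let ?n = "length c"
  obtain i where i: "i < ?n" "c ! i = v" using assms by (auto simp: in_set_conv_nth)
  define j where "j = (if i = 0 then ?n - 1 else i - 1)"
  define h where "h = Suc i mod ?n"
  have j: "j < ?n" "Suc j mod ?n = i" and ne: "j \<noteq> i" "h \<noteq> i" "j \<noteq> h" "h < ?n"
    using i assms(2) by (auto simp: j_def h_def mod_Suc split: if_splits)
  have gap: "(c ! m, c ! (Suc m mod ?n)) \<in># gaps c" if "m < ?n" for m
    using that by (auto simp: gaps_def in_set_zip nth_rotate1)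
  show thesis
    using gap[OF i(1)] gap[OF j(1)] i j ne assms(1)
    by (intro that[of "c ! j" "c ! h"]) (auto simp: nth_eq_iff_index_eq h_def)
qed

section \<open>Cycles with short steps and their extension beyond an extreme vertex\<close>

definition bounded_gaps :: "nat \<Rightarrow> nat list \<Rightarrow> bool" where
  "bounded_gaps p c \<longleftrightarrow> (\<forall>(l, r) \<in># gaps c. l \<le> r + p \<and> r \<le> l + p)"

definition ordered_cycle :: "nat \<Rightarrow> nat list \<Rightarrow> nat set \<Rightarrow> nat list \<Rightarrow> bool" where
  "ordered_cycle p vs S c \<longleftrightarrow>
     distinct c \<and> set c = S \<and> subseq vs c \<and> hd c = hd vs \<and> bounded_gaps p c"

text \<open>
  The two neighbours of \<open>v\<close> are at different distances, so the nearer one is at distance less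
  than \<open>p\<close>, which leaves room for \<open>z\<close> between it and \<open>v\<close>.
\<close>

lemma ordered_cycle_extend:
  assumes c: "ordered_cycle p vs S c" "3 \<le> length c"
    and v: "v \<in> S" and p: "1 \<le> p"
    and z: "(\<forall>s\<in>S. s \<le> v) \<and> z = Suc v \<or> (\<forall>s\<in>S. v \<le> s) \<and> v = Suc z"
  shows "\<exists>c'. ordered_cycle p vs (insert z S) c'"
proof -
  have S: "set c = S" and dist: "distinct c" and bd: "bounded_gaps p c"
    using c by (auto simp: ordered_cycle_def)
  have "z \<notin> set c" using z S by auto
  obtain u w where uw: "(u, v) \<in># gaps c" "(v, w) \<in># gaps c" "u \<noteq> w" "u \<noteq> v" "w \<noteq> v"
    using distinct_neighbours[of c v] dist c v S by blast
  have mem: "u \<in> S" "w \<in> S" using gaps_in_set[OF uw(1)] gaps_in_set[OF uw(2)] S by auto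
  have bounds: "v \<le> u + p" "u \<le> v + p" "v \<le> w + p" "w \<le> v + p"
    using bd uw by (auto simp: bounded_gaps_def)
  consider "z = Suc v" "u \<le> v" "w \<le> v" | "v = Suc z" "v \<le> u" "v \<le> w"
    using z mem by blast
  then have "(z \<le> u + p \<and> u \<le> z + p) \<or> (z \<le> w + p \<and> w \<le> z + p)"
    using bounds \<open>u \<noteq> w\<close> by cases linarith+
  moreover have "z \<le> v + p" "v \<le> z + p" using z p by auto
  ultimately obtain l r where lr: "(l, r) \<in># gaps c"
    and near: "l \<le> z + p" "z \<le> l + p" "r \<le> z + p" "z \<le> r + p"
    using uw by blast
  obtain c' where c': "gaps c' = gaps c - {#(l, r)#} + {#(l, z), (z, r)#}"
    "mset c' = add_mset z (mset c)" "subseq c c'" "hd c' = hd c"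
    using insert_in_gap[OF lr] by blast
  have "distinct c'" "set c' = insert z S"
    using mset_eq_imp_distinct_iff[of c' "z # c"] mset_eq_setD[of c' "z # c"] c'(2)
      \<open>z \<notin> set c\<close> dist S by auto
  moreover have "bounded_gaps p c'"
    using bd near unfolding bounded_gaps_def c'(1) by (auto dest: in_diffD)
  moreover have "subseq vs c'" "hd c' = hd vs"
    using c(1) c'(3,4) subseq_order.order_trans[of vs c c'] by (auto simp: ordered_cycle_def)
  ultimately show ?thesis unfolding ordered_cycle_def by blast
qed

section \<open>Counting the pairs that cross a cut\<close>

text \<open>For \<open>x = Suc y\<close> this counts the pairs crossing the cut after
  \<open>y\<close>; for larger \<open>x\<close>, those among them that reach at least to
  \<open>x\<close>.\<close>

definition spanning :: "nat list \<Rightarrow> nat \<Rightarrow> nat \<Rightarrow> nat" where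
  "spanning c y x = size (filter_mset (\<lambda>(l, r). min l r \<le> y \<and> x \<le> max l r) (gaps c))"

lemma spanning_antimono: "x \<le> x' \<Longrightarrow> spanning c y x' \<le> spanning c y x"
  unfolding spanning_def by (intro size_mset_mono filter_mset_mono_strong) auto

lemma spanning_pos:
  assumes "(l, r) \<in># gaps c" "min l r \<le> y" "x \<le> max l r"
  shows "0 < spanning c y x"
  using assms unfolding spanning_def by (auto simp: nonempty_has_size[symmetric] filter_mset_eq_mempty_iff)

text \<open>Each cut crossed by the split pair is crossed by exactly one half. One half has upper
  end \<open>z\<close> and the other lower end \<open>z\<close>, so for \<open>y < z\<close> neither
  half runs from at most \<open>y\<close> to beyond \<open>z\<close>.\<close>

lemma spanning_insert:
  assumes c': "gaps c' = gaps c - {#(l, r)#} + {#(l, z), (z, r)#}" and lr: "(l, r) \<in># gaps c"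
    and z: "min l r < z" "z < max l r"
  shows "spanning c' y (Suc y) = spanning c y (Suc y)"
    and "min l r \<le> y \<Longrightarrow> y < z \<Longrightarrow> Suc (spanning c' y (Suc z)) = spanning c y (Suc z)"
    and "y < z \<Longrightarrow> spanning c' y (Suc z) \<le> spanning c y (Suc z)"
proof -
  from multi_member_split[OF lr] obtain G where G: "gaps c = add_mset (l, r) G" by blast
  then have c': "gaps c' = G + {#(l, z), (z, r)#}" using c' by simp
  show "spanning c' y (Suc y) = spanning c y (Suc y)"
    using z by (cases "l < r") (auto simp: spanning_def c' G min_def max_def)
  show "min l r \<le> y \<Longrightarrow> y < z \<Longrightarrow> Suc (spanning c' y (Suc z)) = spanning c y (Suc z)"
    using z by (cases "l < r") (auto simp: spanning_def c' G min_def max_def)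
  show "y < z \<Longrightarrow> spanning c' y (Suc z) \<le> spanning c y (Suc z)"
    using z by (cases "l < r") (auto simp: spanning_def c' G min_def max_def)
qed

lemma size_filter_mset_distinct:
  "distinct vs \<Longrightarrow> size (filter_mset P (mset vs)) = card {v \<in> set vs. P v}"
  by (metis distinct_card distinct_filter mset_filter set_filter size_mset)

lemma size_filter_mset_disj:
  "size {#x \<in># M. P x \<or> Q x#} \<le> size (filter_mset P M) + size (filter_mset Q M)"
  by (induction M) auto

text \<open>Each entry is the left end of one pair and the right end of one pair.\<close>

lemma spanning_le_endpoints:
  assumes "distinct vs"
    and cover: "\<And>l r. min l r \<le> y \<Longrightarrow> x \<le> max l r \<Longrightarrow> P l \<or> P r"
  shows "spanning vs y x \<le> 2 * card {v \<in> set vs. P v}"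
proof -
  have "spanning vs y x \<le> size (filter_mset (\<lambda>e. P (fst e) \<or> P (snd e)) (gaps vs))"
    unfolding spanning_def
  proof (intro size_mset_mono filter_mset_mono_strong)
    fix e assume "case e of (l, r) \<Rightarrow> min l r \<le> y \<and> x \<le> max l r"
    then show "P (fst e) \<or> P (snd e)" using cover[of "fst e" "snd e"] by (cases e) simp
  qed simp
  also have "\<dots> \<le> size (filter_mset (\<lambda>e. P (fst e)) (gaps vs)) +
      size (filter_mset (\<lambda>e. P (snd e)) (gaps vs))"
    by (rule size_filter_mset_disj)
  also have "size (filter_mset (\<lambda>e. P (fst e)) (gaps vs)) = size (filter_mset P (mset vs))"
    unfolding image_fst_gaps[symmetric] by (simp add: filter_mset_image_mset)
  also have "size (filter_mset (\<lambda>e. P (snd e)) (gaps vs)) = size (filter_mset P (mset vs))"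
    unfolding image_snd_gaps[symmetric] by (simp add: filter_mset_image_mset)
  finally show ?thesis using assms by (simp add: size_filter_mset_distinct)
qed

section \<open>The scan between the extreme prescribed vertices\<close>

text \<open>
  The state of the insertion procedure when it arrives at \<open>x\<close>. The gaps counted by
  \<^term>\<open>spanning c y x\<close> are those that the procedure prefers to a gap with lower end above
  \<open>y\<close>, so each new vertex after \<open>y\<close> reduces their number, which is at first
  \<^term>\<open>spanning vs y (Suc y)\<close>.
\<close>

definition scan_inv :: "nat \<Rightarrow> nat list \<Rightarrow> nat \<Rightarrow> nat \<Rightarrow> nat list \<Rightarrow> bool" where
  "scan_inv p vs a x c \<longleftrightarrow>
     distinct c \<and> set c = set vs \<union> {a..<x} \<and> subseq vs c \<and> hd c = hd vs \<and>
     (\<forall>y. spanning c y (Suc y) = spanning vs y (Suc y)) \<and>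
     (\<forall>(l, r) \<in># gaps c. max l r < x \<longrightarrow> max l r \<le> min l r + p) \<and>
     (\<forall>y\<in>{a..<x}. spanning c y x = 0 \<or>
        card ({y<..<x} - set vs) + spanning c y x \<le> spanning vs y (Suc y))"

text \<open>Let \<open>m\<close> be the smaller of the numbers of prescribed vertices up to
  \<open>y\<close> and after \<open>y\<close>, and \<open>h\<close> the latter. Strictly between
  \<open>y\<close> and \<open>x\<close> lie at most \<open>2 * m - 1\<close> free and
  \<open>h - 1\<close> prescribed vertices. Now use \<open>m + h \<le> k\<close> and
  \<open>m \<le> k div 2\<close>.\<close>

lemma scan_gap_bound:
  assumes vs: "distinct vs" "length vs = k"
    and b: "b \<in> set vs" "x \<le> b" and yx: "y < x"
    and U: "card ({y<..<x} - set vs) < spanning vs y (Suc y)"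
  shows "x \<le> y + (k + k div 2 - 1)"
proof -
  let ?lo = "{v \<in> set vs. v \<le> y}" and ?hi = "{v \<in> set vs. y < v}"
  have "?lo \<union> ?hi = set vs" "?lo \<inter> ?hi = {}" by auto
  then have k: "card ?lo + card ?hi = k"
    using card_Un_disjoint[of ?lo ?hi] vs by (simp add: distinct_card)
  have "card (insert b ({y<..<x} \<inter> set vs)) \<le> card ?hi"
    using b yx by (intro card_mono) auto
  \<comment> \<open>Strict because \<open>b\<close> is prescribed and lies at or beyond
    \<open>x\<close>.\<close>
  then have mid: "card ({y<..<x} \<inter> set vs) < card ?hi" using b by simp
  have "card {y<..<x} = card ({y<..<x} - set vs) + card ({y<..<x} \<inter> set vs)"
    using card_Un_disjoint[of "{y<..<x} - set vs" "{y<..<x} \<inter> set vs"]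
    by (auto simp: Un_Diff_Int simp del: card_greaterThanLessThan)
  moreover have "spanning vs y (Suc y) \<le> 2 * card ?lo"
    using vs by (intro spanning_le_endpoints) auto
  moreover have "spanning vs y (Suc y) \<le> 2 * card ?hi"
    using vs by (intro spanning_le_endpoints) auto
  ultimately have "x \<le> y + (2 * min (card ?lo) (card ?hi) + card ?hi - 1)"
    using U mid yx by simp
  moreover have "min (card ?lo) (card ?hi) \<le> k div 2" "min (card ?lo) (card ?hi) + card ?hi \<le> k"
    using k by (auto simp: less_eq_div_iff_mult_less_eq)
  ultimately show ?thesis by linarith
qed

lemma scan_step:
  assumes vs: "distinct vs" "length vs = k" and p: "p = k + k div 2 - 1"
    and a: "a \<in> set vs" "\<forall>v\<in>set vs. a \<le> v" and b: "b \<in> set vs" "x \<le> b" and ax: "a \<le> x"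
    and inv: "scan_inv p vs a x c"
  shows "\<exists>c'. scan_inv p vs a (Suc x) c'"
proof -
  note inv' = inv[unfolded scan_inv_def]
  from inv' have set_c: "set c = set vs \<union> {a..<x}" and dist: "distinct c"
    and cut: "\<And>y. spanning c y (Suc y) = spanning vs y (Suc y)"
    and fin: "\<And>l r. (l, r) \<in># gaps c \<Longrightarrow> max l r < x \<Longrightarrow> max l r \<le> min l r + p"
    and count: "\<And>y. a \<le> y \<Longrightarrow> y < x \<Longrightarrow> spanning c y x = 0 \<or>
        card ({y<..<x} - set vs) + spanning c y x \<le> spanning vs y (Suc y)"
    by auto
  \<comment> \<open>The pair itself makes the count for its lower end positive, so the invariant
    leaves strictly fewer free vertices than crossing pairs, as \<open>scan_gap_bound\<close>
    requires.\<close>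
  have close: "x \<le> min l r + p" if "(l, r) \<in># gaps c" "x \<le> max l r" for l r
  proof (cases "min l r < x")
    case True
    have "a \<le> min l r" using gaps_in_set[OF that(1)] set_c a by auto
    with True count[of "min l r"] spanning_pos[OF that(1) order_refl that(2)]
    have "card ({min l r<..<x} - set vs) < spanning vs (min l r) (Suc (min l r))" by auto
    from scan_gap_bound[OF vs b True this] show ?thesis unfolding p .
  qed simp
  have short: "case e of (l, r) \<Rightarrow> max l r < Suc x \<longrightarrow> max l r \<le> min l r + p" if "e \<in># gaps c" for e
  proof (clarify, rule ccontr)
    fix l r assume e: "e = (l, r)" and "max l r < Suc x" and far: "\<not> max l r \<le> min l r + p"
    have gap: "(l, r) \<in># gaps c" using that e by simp
    with far fin have "\<not> max l r < x" by blast
    with \<open>max l r < Suc x\<close> have "max l r = x" by linarith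
    with close[OF gap] far show False by simp
  qed
  show ?thesis
  proof (cases "x \<in> set vs")
    case True
    have "scan_inv p vs a (Suc x) c"
      unfolding scan_inv_def
    proof (intro conjI ballI allI)
      show "set c = set vs \<union> {a..<Suc x}"
        unfolding set_c atLeastLessThanSuc using True ax by auto
    next
      fix e assume "e \<in># gaps c"
      then show "case e of (l, r) \<Rightarrow> max l r < Suc x \<longrightarrow> max l r \<le> min l r + p"
        by (rule short)
    next
      fix y assume y: "y \<in> {a..<Suc x}"
      show "spanning c y (Suc x) = 0 \<or>
        card ({y<..<Suc x} - set vs) + spanning c y (Suc x) \<le> spanning vs y (Suc y)"
      proof (cases "y = x")
        case True
        \<comment> \<open>No vertex has been scanned after \<open>x\<close> yet, so the bound is the
          equality of cut counts.\<close>
        have "{x<..<Suc x} = {}" by auto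
        then show ?thesis using cut True by simp
      next
        case False
        have "{y<..<Suc x} - set vs = {y<..<x} - set vs" using True by (auto simp: less_Suc_eq)
        then show ?thesis
          using count[of y] spanning_antimono[of x "Suc x" c y] False y by auto
      qed
    qed (use inv' in auto)
    then show ?thesis by blast
  next
    case False
    \<comment> \<open>The pairs that can receive \<open>x\<close>. There is one, since the cycle
      must leave the vertices below \<open>x\<close> to reach \<open>b\<close>.\<close>
    define Act where "Act = {(l, r). (l, r) \<in># gaps c \<and> min l r < x \<and> x < max l r}"
    have "x \<notin> set c" using False set_c by auto
    have "a \<in> set c" "b \<in> set c" "a < x" "x < b"
      using a b ax False set_c by (auto simp: order_less_le)
    then obtain l r where "(l, r) \<in># gaps c" "l \<in> {..<x}" "r \<notin> {..<x}"
      using exists_leaving_gap[of a c "{..<x}" b] by auto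
    then have "(l, r) \<in> Act"
      using gaps_in_set(2)[of l r c] \<open>x \<notin> set c\<close> by (cases "r = x") (auto simp: Act_def)
    then obtain e where e: "e \<in> Act"
      "\<And>e'. e' \<in> Act \<Longrightarrow> min (fst e) (snd e) \<le> min (fst e') (snd e')"
      using exists_least_iff[of "\<lambda>m. \<exists>e\<in>Act. m = min (fst e) (snd e)"]
      by (metis linorder_not_less)
    obtain l r where lr_e: "e = (l, r)" by (cases e)
    have lr: "(l, r) \<in># gaps c" "min l r < x" "x < max l r" using e(1) lr_e by (auto simp: Act_def)
    \<comment> \<open>Whenever some pair counted for \<open>y\<close> extends beyond
      \<open>x\<close>, the chosen pair is itself counted for \<open>y\<close>, and splitting it
      lowers that count.\<close>
    have least: "min l r \<le> y" if "0 < spanning c y (Suc x)" "y < x" for y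
    proof -
      from that(1) obtain l' r' where "(l', r') \<in># gaps c" "min l' r' \<le> y" "Suc x \<le> max l' r'"
        unfolding spanning_def nonempty_has_size[symmetric] by (auto simp: filter_mset_eq_mempty_iff)
      then have "(l', r') \<in> Act" using that(2) by (auto simp: Act_def)
      from e(2)[OF this] have "min l r \<le> min l' r'" unfolding lr_e fst_conv snd_conv .
      then show ?thesis using \<open>min l' r' \<le> y\<close> by (rule order_trans)
    qed
    obtain c' where c': "gaps c' = gaps c - {#(l, r)#} + {#(l, x), (x, r)#}"
      "mset c' = add_mset x (mset c)" "subseq c c'" "hd c' = hd c"
      using insert_in_gap[OF lr(1)] by blast
    note span' = spanning_insert[OF c'(1) lr]
    have "scan_inv p vs a (Suc x) c'"
      unfolding scan_inv_def
    proof (intro conjI ballI allI)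
      show "distinct c'" "set c' = set vs \<union> {a..<Suc x}"
        using mset_eq_imp_distinct_iff[of c' "x # c"] mset_eq_setD[of c' "x # c"] c'(2)
          \<open>x \<notin> set c\<close> dist set_c ax by (auto simp: atLeastLessThanSuc)
      show "subseq vs c'" using inv' c'(3) subseq_order.trans by blast
      show "hd c' = hd vs" using inv' c'(4) by simp
      show "spanning c' y (Suc y) = spanning vs y (Suc y)" for y using span'(1) cut by simp
    next
      fix e' assume "e' \<in># gaps c'"
      then consider "e' \<in># gaps c" | "e' = (l, x)" | "e' = (x, r)"
        unfolding c'(1) by (auto dest: in_diffD)
      then show "case e' of (l, r) \<Rightarrow> max l r < Suc x \<longrightarrow> max l r \<le> min l r + p"
      proof cases
        case 1
        then show ?thesis by (rule short)
      \<comment> \<open>Of the two halves, only the one with upper end \<open>x\<close> is finished,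
        and \<open>close\<close> bounds its length.\<close>
      qed (use close[OF lr(1)] lr in \<open>auto simp: min_def max_def split: if_splits\<close>)
    next
      fix y assume y: "y \<in> {a..<Suc x}"
      show "spanning c' y (Suc x) = 0 \<or>
        card ({y<..<Suc x} - set vs) + spanning c' y (Suc x) \<le> spanning vs y (Suc y)"
      proof (cases "y = x")
        case True
        have "{x<..<Suc x} = {}" by auto
        then show ?thesis using cut span'(1) True by simp
      next
        case neq: False
        show ?thesis
        proof (cases "spanning c y (Suc x) = 0")
          case True
          then show ?thesis using span'(3)[of y] neq y by simp
        next
          case pos: False
          \<comment> \<open>The free vertex \<open>x\<close> adds one to the first summand, and the
            split takes one from the second.\<close>
          then have "Suc (spanning c' y (Suc x)) = spanning c y (Suc x)"
            using least span'(2)[of y] neq y by simp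
          moreover have "{y<..<Suc x} - set vs = insert x ({y<..<x} - set vs)"
            using False neq y by auto
          then have "card ({y<..<Suc x} - set vs) = Suc (card ({y<..<x} - set vs))" by simp
          moreover have "spanning c y (Suc x) \<le> spanning c y x" by (rule spanning_antimono) simp
          ultimately show ?thesis using count[of y] neq y pos by auto
        qed
      qed
    qed
    then show ?thesis by blast
  qed
qed

section \<open>From the prescribed vertices to the whole path\<close>

lemma ordered_cycle_hull:
  assumes vs: "distinct vs" "length vs = k" and p: "p = k + k div 2 - 1"
    and a: "a \<in> set vs" "\<forall>v\<in>set vs. a \<le> v" and b: "b \<in> set vs" "\<forall>v\<in>set vs. v \<le> b"
  shows "\<exists>c. ordered_cycle p vs {a..b} c"
proof -
  have "\<exists>c. scan_inv p vs a (a + d) c" if "a + d \<le> Suc b" for d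
    using that
  proof (induction d)
    case 0
    \<comment> \<open>No pair lies entirely below \<open>a\<close> and no vertex has been scanned,
      so the last two conditions are vacuous.\<close>
    have "scan_inv p vs a a vs"
      using vs a by (fastforce simp: scan_inv_def dest: gaps_in_set)
    then show ?case by auto
  next
    case (Suc d)
    then obtain c where "scan_inv p vs a (a + d) c" by auto
    then show ?case using scan_step[OF vs p a b(1), of "a + d" c] Suc.prems by simp
  qed
  \<comment> \<open>Past \<open>b\<close> every pair is finished, so the length bound holds for all
    of them.\<close>
  from this[of "Suc b - a"] obtain c where c: "scan_inv p vs a (Suc b) c"
    using a b by fastforce
  then have set_c: "set c = {a..b}" using a b by (auto simp: scan_inv_def)
  have "bounded_gaps p c"
    unfolding bounded_gaps_def
  proof clarify
    fix l r assume lr: "(l, r) \<in># gaps c"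
    then have "max l r < Suc b" using gaps_in_set[OF lr] set_c by auto
    then have "max l r \<le> min l r + p" using c lr by (auto simp: scan_inv_def)
    then show "l \<le> r + p \<and> r \<le> l + p" by auto
  qed
  then show ?thesis using c set_c unfolding scan_inv_def ordered_cycle_def by blast
qed

lemma ordered_cycle_path:
  assumes vs: "distinct vs" "length vs = k" "set vs \<subseteq> {..<n}"
    and k: "3 \<le> k" and p: "p = k + k div 2 - 1"
  shows "\<exists>c. ordered_cycle p vs {..<n} c"
proof -
  define a b where "a = Min (set vs)" and "b = Max (set vs)"
  have "set vs \<noteq> {}" using vs k by auto
  then have a: "a \<in> set vs" "\<forall>v\<in>set vs. a \<le> v" and b: "b \<in> set vs" "\<forall>v\<in>set vs. v \<le> b"
    by (auto simp: a_def b_def)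
  have len: "3 \<le> length c" if "ordered_cycle p vs S c" for S c
    using that vs k by (auto simp: ordered_cycle_def dest: list_emb_length)
  have ab: "a \<le> b" using a b by auto
  \<comment> \<open>First extend downwards from \<open>a\<close> to 0, then upwards from
    \<open>b\<close> to \<open>n - 1\<close>.\<close>
  have down: "\<exists>c. ordered_cycle p vs {a - d..b} c" if "d \<le> a" for d
    using that
  proof (induction d)
    case 0
    show ?case using ordered_cycle_hull[OF vs(1,2) p a b] by simp
  next
    case (Suc d)
    then obtain c where c: "ordered_cycle p vs {a - d..b} c" by auto
    have "insert (a - Suc d) {a - d..b} = {a - Suc d..b}" using Suc.prems ab by auto
    moreover have "a - d = Suc (a - Suc d)" using Suc.prems by simp
    ultimately show ?case
      using ordered_cycle_extend[OF c len[OF c], of "a - d" "a - Suc d"] ab k p by auto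
  qed
  have up: "\<exists>c. ordered_cycle p vs {0..b + d} c" for d
  proof (induction d)
    case 0
    show ?case using down[of a] by simp
  next
    case (Suc d)
    then obtain c where c: "ordered_cycle p vs {0..b + d} c" by auto
    have "insert (Suc (b + d)) {0..b + d} = {0..b + Suc d}" by auto
    with ordered_cycle_extend[OF c len[OF c], of "b + d" "Suc (b + d)"] k p
    show ?case by auto
  qed
  have "b < n" using b vs by auto
  then have "{0..b + (n - Suc b)} = {..<n}" by auto
  with up[of "n - Suc b"] show ?thesis by simp
qed

section \<open>Hamiltonian cycles in powers of the path\<close>

lemma arc_power_path:
  assumes "i < n" "j < n" "i \<noteq> j" "i \<le> j + p" "j \<le> i + p"
  shows "(i, j) \<in> parcs (graph_power (path_graph n) p)"
proof -
  have "ereal \<bar>real i - real j\<bar> \<le> ereal (real p)" using assms by auto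
  with graph_dist_path_graph_le[OF assms(1,2)]
  have "graph_dist (path_graph n) i j \<le> ereal (real p)" by (rule order_trans)
  with assms show ?thesis by (simp add: graph_power_def path_graph_def)
qed

lemma k_ordered_hamiltonian_power_path:
  assumes k: "3 \<le> k"
  shows "k_ordered_hamiltonian k (graph_power (path_graph n) (k + k div 2 - 1))"
    (is "k_ordered_hamiltonian k ?G")
  unfolding k_ordered_hamiltonian_def
proof (intro allI impI, elim conjE)
  fix vs assume vs: "length vs = k" "distinct vs" "set vs \<subseteq> pverts ?G"
  have verts: "pverts ?G = {..<n}" by (simp add: graph_power_def path_graph_def)
  obtain c where c: "ordered_cycle (k + k div 2 - 1) vs {..<n} c"
    using ordered_cycle_path[of vs k n] vs k verts by auto
  then have dist: "distinct c" and set_c: "set c = {..<n}" and sub: "subseq vs c"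
    and hd: "hd c = hd vs" and bd: "bounded_gaps (k + k div 2 - 1) c"
    by (auto simp: ordered_cycle_def)
  have len: "3 \<le> length c" using list_emb_length[OF sub] vs k by simp
  have "set (zip c (rotate1 c)) \<subseteq> parcs ?G"
  proof clarify
    fix i j assume ij: "(i, j) \<in> set (zip c (rotate1 c))"
    then have gap: "(i, j) \<in># gaps c" by (simp add: gaps_def)
    from ij obtain m where m: "m < length c" "i = c ! m" "j = c ! (Suc m mod length c)"
      by (auto simp: in_set_zip nth_rotate1)
    have "Suc m mod length c \<noteq> m" "Suc m mod length c < length c"
      using m(1) len by (auto simp: mod_Suc)
    then have "i \<noteq> j" using m dist by (simp add: nth_eq_iff_index_eq)
    then show "(i, j) \<in> parcs ?G"
      using bd gap gaps_in_set[OF gap] set_c by (intro arc_power_path) (auto simp: bounded_gaps_def)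
  qed
  then have "hamiltonian_cycle ?G (zip c (rotate1 c))"
    using dist set_c verts len by (intro hamiltonian_cycleI) auto
  moreover have "fst (hd (zip c (rotate1 c))) = hd vs"
    using len hd by (cases c; cases "rotate1 c") auto
  ultimately show "\<exists>c. hamiltonian_cycle ?G c \<and> fst (hd c) = hd vs \<and> subseq vs (map fst c)"
    using sub by (intro exI[of _ "zip c (rotate1 c)"]) auto
qed

theorem theorem3p2:
  fixes n k :: nat
  assumes "3 \<le> k" and "k \<le> n"
  shows "int (ordered_power_number k (path_graph n)) \<le> \<lfloor>3 * real k / 2\<rfloor> - 1"
proof -
  have "ordered_power_number k (path_graph n) \<le> k + k div 2 - 1"
    unfolding ordered_power_number_def using k_ordered_hamiltonian_power_path[of k n] assms
    by (intro Least_le) auto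
  \<comment> \<open>The two forms of the bound agree because
    \<open>3 * k div 2 = k + k div 2\<close>.\<close>
  moreover have "\<lfloor>3 * real k / 2\<rfloor> = int (3 * k div 2)"
    using floor_divide_of_nat_eq[of "3 * k" 2, where 'a = real] by simp
  ultimately show ?thesis using assms(1) by linarith
qed

end
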